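(* Let $X$ be a $T_1$ topological space that is both a Baire space and a $P$-space, and let $\{f_n\}$ be a sequence of functions in $T'(X)$ that converges uniformly on $X$ to a function $f : X \to \mathbb{R}$. Then $f \in T'(X)$.
   Context: $T'(X)$ denotes the ring of all functions $f : X \to \mathbb{R}$ for which there is an open dense subset $D \subseteq X$ such that the restriction $f|_D$ is continuous. A topological space is a Baire space if every countable intersection of open dense subsets is dense. A topological space is a $P$-space if every $G_\delta$-set in it is open. *)

theory Defs
  imports "HOL-Analysis.Analysis"
begin

definition open_dense_in :: "'a topology \<Rightarrow> 'a set \<Rightarrow> bool" where
  "open_dense_in X D \<longleftrightarrow> openin X D \<and> X closure_of D = topspace X"

(* Functions on X are HOL functions whose values outside topspace X are irrelevant:
   membership depends only on the restriction of f to topspace X. *)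
definition Tprime :: "'a topology \<Rightarrow> ('a \<Rightarrow> real) set" where
  "Tprime X = {f. \<exists>D. open_dense_in X D \<and> continuous_map (subtopology X D) euclideanreal f}"

(* The empty family is harmless: its intersection is UNIV, and X closure_of UNIV = topspace X. *)
definition Baire_space :: "'a topology \<Rightarrow> bool" where
  "Baire_space X \<longleftrightarrow>
     (\<forall>\<G>. countable \<G> \<and> (\<forall>G\<in>\<G>. open_dense_in X G) \<longrightarrow> X closure_of (\<Inter>\<G>) = topspace X)"

definition P_space :: "'a topology \<Rightarrow> bool" where
  "P_space X \<longleftrightarrow> (\<forall>S. gdelta_in X S \<longrightarrow> openin X S)"

end

theory Submission
  imports Defs
begin

text \<open>
  For each \<open>n\<close> choose an open dense set \<open>D n\<close> on which \<open>fs n\<close> is continuous, and let \<open>E\<close> be the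
  intersection of the \<open>D n\<close>. The Baire property makes \<open>E\<close> dense, and the P-space property makes
  the \<open>G\<^sub>\<delta>\<close> set \<open>E\<close> open. All the \<open>fs n\<close> are continuous on \<open>E\<close>, hence so is their uniform limit.
\<close>

lemma open_dense_in_INT:
  fixes D :: "nat \<Rightarrow> 'a set"
  assumes "Baire_space X" and "P_space X" and "\<And>n. open_dense_in X (D n)"
  shows "open_dense_in X (\<Inter>n. D n)"
proof -
  have "gdelta_in X (\<Inter>n. D n)"
    using assms(3) by (intro gdelta_in_Inter) (auto simp: open_dense_in_def open_imp_gdelta_in)
  then have "openin X (\<Inter>n. D n)"
    using assms(2) by (simp add: P_space_def)
  moreover have "countable (range D) \<and> (\<forall>G\<in>range D. open_dense_in X G)"
    using assms(3) by auto
  then have "X closure_of (\<Inter>n. D n) = topspace X"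
    using assms(1) unfolding Baire_space_def by blast
  ultimately show ?thesis
    by (simp add: open_dense_in_def)
qed

theorem theorem2p11:
  fixes X :: "'a topology"
    and fs :: "nat \<Rightarrow> 'a \<Rightarrow> real"
    and f :: "'a \<Rightarrow> real"
  assumes "t1_space X"
    and "Baire_space X"
    and "P_space X"
    and "\<And>n. fs n \<in> Tprime X"
    and "uniform_limit (topspace X) fs f sequentially"
  shows "f \<in> Tprime X"
proof -
  have "\<forall>n. \<exists>D. open_dense_in X D \<and> continuous_map (subtopology X D) euclideanreal (fs n)"
    using assms(4) by (simp add: Tprime_def)
  then obtain D where D: "\<And>n. open_dense_in X (D n)"
    and cont: "\<And>n. continuous_map (subtopology X (D n)) euclideanreal (fs n)"
    by metis
  define E where "E = (\<Inter>n. D n)"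
  have "open_dense_in X E"
    unfolding E_def using assms(2,3) D by (rule open_dense_in_INT)
  moreover have "continuous_map (subtopology X E) euclideanreal (fs n)" for n
    using cont[of n] by (rule continuous_map_from_subtopology_mono) (auto simp: E_def)
  moreover have "\<forall>\<^sub>F n in sequentially. \<forall>x\<in>topspace (subtopology X E). dist (fs n x) (f x) < \<epsilon>"
    if "\<epsilon> > 0" for \<epsilon>
    using uniform_limitD[OF assms(5) that] by eventually_elim auto
  ultimately have "continuous_map (subtopology X E) euclideanreal f"
    using Met_TC.continuous_map_uniform_limit[of "subtopology X E" fs sequentially f] by simp
  with \<open>open_dense_in X E\<close> show ?thesis
    by (auto simp: Tprime_def)
qed

end
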